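(* Let $\mathcal D_{\mathrm{tr}}$ be a (random) training data set of residual injections in $\mathbb R^n$, and let the residual mean estimate $\widehat{\bm\mu}_r\in\mathbb R^n$ be computed using only $\mathcal D_{\mathrm{tr}}$. Let $\bm r^{(1)},\dots,\bm r^{(N_{\mathrm{cal}})}$ be the calibration residuals, and suppose that they and a future residual $\bm r^{\mathrm{new}}$ (all random vectors in $\mathbb R^n$) are exchangeable conditional on $\mathcal D_{\mathrm{tr}}$. Let $\epsilon^+,\epsilon^-\in(0,1)$ be prescribed tail violation probabilities with $\epsilon^++\epsilon^-=\epsilon$. For each line $\ell\in\mathcal E$ let $m_\ell^+$ and $m_\ell^-$ be the linewise split-conformal margins computed from the calibration residuals at levels $\epsilon^+$ and $\epsilon^-$ (as defined in the context), and let $$\mathcal M_\ell(\bm r^{\mathrm{new}})=\left\{-m_\ell^-\le \left[K(\bm r^{\mathrm{new}}-\widehat{\bm\mu}_r)\right]_\ell\le m_\ell^+\right\}.$$ Then $$\mathbb P\left(\mathcal M_\ell(\bm r^{\mathrm{new}})\,\middle|\,\mathcal D_{\mathrm{tr}}\right)\ge 1-\epsilon\qquad\text{for all }\ell\in\mathcal E.$$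
   Context: Network: $\mathcal G=(\mathcal N,\mathcal E)$ is a connected graph with $n$ buses (nodes) and finitely many transmission lines (edges), each arbitrarily oriented. $A\in\mathbb R^{|\mathcal E|\times n}$ is the line-bus incidence matrix, $B=\operatorname{diag}(b_\ell)$ is the diagonal matrix of line susceptances, $L=A^\top BA$ is the weighted Laplacian (with $\operatorname{null}(L)=\operatorname{span}\{\bm 1\}$), $L^\dagger$ is its Moore--Penrose pseudo-inverse, $f_\ell^{\max}>0$ are thermal limits, $D=\operatorname{diag}(1/f_\ell^{\max})$, and $K=DBAL^\dagger\in\mathbb R^{|\mathcal E|\times n}$ is the injection-to-line-loading map. Residuals: all residuals are of the form $\bm r=(I-\bm\alpha\bm 1^\top)\bm\omega$ for a random forecast error $\bm\omega\in\mathbb R^n$ and a fixed $\bm\alpha\in\mathbb R^n_+$ with $\bm 1^\top\bm\alpha=1$. In the paper $\widehat{\bm\mu}_r$ is the sample mean of the residuals in $\mathcal D_{\mathrm{tr}}$. Linewise margins: for a residual $\bm r$ put $y_\ell(\bm r)=[K(\bm r-\widehat{\bm\mu}_r)]_\ell$ and write $y_\ell^{(i)}=y_\ell(\bm r^{(i)})$, $i=1,\dots,N_{\mathrm{cal}}$, for the calibration residuals. With $[x]_+=\max\{x,0\}$, define the nonconformity scores $R_{i,\ell}^+=[y_\ell^{(i)}]_+$ and $R_{i,\ell}^-=[-y_\ell^{(i)}]_+$. Let $R_{(1),\ell}^{\pm}\le\cdots\le R_{(N_{\mathrm{cal}}),\ell}^{\pm}$ be the ordered calibration scores for line $\ell$,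 with $R^{\pm}_{(N_{\mathrm{cal}}+1),\ell}=+\infty$. Set $k^\pm=\lceil (N_{\mathrm{cal}}+1)(1-\epsilon^\pm)\rceil$ and $$m_\ell^+=R^{+}_{(k^+),\ell},\qquad m_\ell^-=R^{-}_{(k^-),\ell}.$$ The probability is over the joint draw of the calibration residuals (on which the margins depend) and $\bm r^{\mathrm{new}}$, conditionally on $\mathcal D_{\mathrm{tr}}$. *)

theory Defs
  imports
    "HOL-Probability.Probability"
    "HOL-Combinatorics.Permutations"
    "Graph_Theory.Digraph_Component"
begin

text \<open>
  A network is a \<open>pre_digraph\<close> whose vertices are all of \<open>'n\<close> (the buses) and whose arcs are
  all of \<open>'e\<close> (the lines); the direction of an arc is the arbitrary orientation of the line.
  Matrices are then indexed by these types.
\<close>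

definition diag_matrix :: "real^'e \<Rightarrow> real^'e^'e" where
  "diag_matrix d = (\<chi> i j. if i = j then d $ i else 0)"

definition incidence_matrix :: "('n, 'e) pre_digraph \<Rightarrow> real^'n^'e" where
  "incidence_matrix G =
     (\<chi> l i. if i = tail G l then 1 else if i = head G l then -1 else 0)"

definition laplacian :: "('n, 'e) pre_digraph \<Rightarrow> real^'e \<Rightarrow> real^'n^'n" where
  "laplacian G b =
     transpose (incidence_matrix G) ** diag_matrix b ** incidence_matrix G"

definition penrose_inverse :: "real^'n^'m \<Rightarrow> real^'m^'n \<Rightarrow> bool" where
  "penrose_inverse M X \<longleftrightarrow>
     M ** X ** M = M \<and> X ** M ** X = X \<and>
     transpose (M ** X) = M ** X \<and> transpose (X ** M) = X ** M"

definition pseudo_inverse :: "real^'n^'m \<Rightarrow> real^'m^'n" where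
  "pseudo_inverse M = (THE X. penrose_inverse M X)"

definition loading_matrix :: "('n, 'e) pre_digraph \<Rightarrow> real^'e \<Rightarrow> real^'e \<Rightarrow> real^'n^'e" where
  "loading_matrix G b fmax =
     diag_matrix (\<chi> l. 1 / fmax $ l) ** diag_matrix b ** incidence_matrix G
       ** pseudo_inverse (laplacian G b)"

definition residual :: "real^'n \<Rightarrow> real^'n \<Rightarrow> real^'n" where
  "residual \<alpha> w = (mat 1 - (columnvector \<alpha> :: real^1^'n) ** rowvector 1) *v w"

text \<open>
  The sigma-algebra generated by a finite family of training vectors, and the conditional
  probability of an event given a sub-sigma-algebra (a random variable, determined up to null
  sets).
\<close>

definition generated_algebra ::
    "'a measure \<Rightarrow> nat \<Rightarrow> (nat \<Rightarrow> 'a \<Rightarrow> 'b::topological_space) \<Rightarrow> 'a measure" where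
  "generated_algebra M N X =
     vimage_algebra (space M) (\<lambda>x. \<lambda>j\<in>{1..N}. X j x) (\<Pi>\<^sub>M j\<in>{1..N}. borel)"

definition cond_probability :: "'a measure \<Rightarrow> 'a measure \<Rightarrow> 'a set \<Rightarrow> 'a \<Rightarrow> real" where
  "cond_probability M F E = real_cond_exp M F (indicat_real E)"

definition cond_exchangeable ::
    "'a measure \<Rightarrow> 'a measure \<Rightarrow> 'i set \<Rightarrow> ('i \<Rightarrow> 'a \<Rightarrow> 'b::topological_space) \<Rightarrow> bool" where
  "cond_exchangeable M F I X \<longleftrightarrow>
     (\<forall>\<pi>. \<pi> permutes I \<longrightarrow> (\<forall>B \<in> sets (\<Pi>\<^sub>M i\<in>I. borel).
        AE x in M.
          cond_probability M F {z \<in> space M. (\<lambda>i\<in>I. X (\<pi> i) z) \<in> B} x =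
          cond_probability M F {z \<in> space M. (\<lambda>i\<in>I. X i z) \<in> B} x))"

text \<open>
  The order statistic of rank \<open>\<lceil>(N + 1)(1 - \<epsilon>)\<rceil>\<close> of the scores \<open>R 1, \<dots>, R N\<close>, the one of rank
  \<open>N + 1\<close> being infinite. For \<open>0 < \<epsilon> < 1\<close> the rank lies between \<open>1\<close> and \<open>N + 1\<close>; list indices
  start at \<open>0\<close>.
\<close>

definition conformal_quantile :: "nat \<Rightarrow> real \<Rightarrow> (nat \<Rightarrow> real) \<Rightarrow> ereal" where
  "conformal_quantile N \<epsilon> R =
     (map ereal (sort (map R [1..<Suc N])) @ [\<infinity>]) ! (nat \<lceil>real (N + 1) * (1 - \<epsilon>)\<rceil> - 1)"

definition line_deviation :: "real^'n^'e \<Rightarrow> real^'n \<Rightarrow> 'e \<Rightarrow> real^'n \<Rightarrow> real" where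
  "line_deviation K \<mu> l r = (K *v (r - \<mu>)) $ l"

definition upper_margin ::
    "real^'n^'e \<Rightarrow> real^'n \<Rightarrow> nat \<Rightarrow> (nat \<Rightarrow> real^'n) \<Rightarrow> real \<Rightarrow> 'e \<Rightarrow> ereal" where
  "upper_margin K \<mu> N r \<epsilon> l =
     conformal_quantile N \<epsilon> (\<lambda>i. max (line_deviation K \<mu> l (r i)) 0)"

definition lower_margin ::
    "real^'n^'e \<Rightarrow> real^'n \<Rightarrow> nat \<Rightarrow> (nat \<Rightarrow> real^'n) \<Rightarrow> real \<Rightarrow> 'e \<Rightarrow> ereal" where
  "lower_margin K \<mu> N r \<epsilon> l =
     conformal_quantile N \<epsilon> (\<lambda>i. max (- line_deviation K \<mu> l (r i)) 0)"

end

theory Submission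
  imports Defs
begin

text \<open>
  Let \<open>S 1, \<dots>, S (N + 1)\<close> be the scores of the calibration residuals and of the new one, and let
  \<open>k\<close> be the rank of the margin. The new score exceeds the margin iff at least \<open>k\<close> of the scores
  lie strictly below it. At most \<open>N + 1 - k\<close> indices \<open>j\<close> can have \<open>k\<close> scores strictly below
  \<open>S j\<close>, and by exchangeability these \<open>N + 1\<close> events have the same probability on each event
  \<open>A\<close> of the training sigma-algebra. Hence the new score exceeds the margin with probability at
  most \<open>(N + 1 - k) / (N + 1) * P(A) \<le> \<epsilon> * P(A)\<close> on \<open>A\<close>. A union bound over the two tails
  gives the claim, as \<open>A\<close> was arbitrary.
\<close>

section \<open>Order statistics and ranks\<close>

text \<open>The entries below \<open>s\<close> form an initial segment of a sorted list, so position
  \<open>k\<close>, counted from 0, is below \<open>s\<close> exactly when this segment has more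
  than \<open>k\<close> entries.\<close>

lemma sorted_nth_less_iff:
  fixes xs :: "'a::linorder list"
  assumes "sorted xs" "k < length xs"
  shows "xs ! k < s \<longleftrightarrow> Suc k \<le> length (filter (\<lambda>x. x < s) xs)"
proof
  assume "xs ! k < s"
  have "\<forall>x\<in>set (take (Suc k) xs). x < s"
  proof
    fix x assume "x \<in> set (take (Suc k) xs)"
    then obtain i where "i < Suc k" "x = xs ! i" "i < length xs"
      by (auto simp: in_set_conv_nth)
    then show "x < s"
      using sorted_nth_mono[OF assms(1), of i k] assms(2) \<open>xs ! k < s\<close> by auto
  qed
  then have "length (filter (\<lambda>x. x < s) (take (Suc k) xs)) = Suc k"
    using assms(2) by simp
  moreover have "length (filter (\<lambda>x. x < s) xs) =
      length (filter (\<lambda>x. x < s) (take (Suc k) xs)) + length (filter (\<lambda>x. x < s) (drop (Suc k) xs))"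
    by (metis append_take_drop_id filter_append length_append)
  ultimately show "Suc k \<le> length (filter (\<lambda>x. x < s) xs)"
    by simp
next
  assume len: "Suc k \<le> length (filter (\<lambda>x. x < s) xs)"
  show "xs ! k < s"
  proof (rule ccontr)
    assume "\<not> xs ! k < s"
    have "{i. i < length xs \<and> xs ! i < s} \<subseteq> {..<k}"
      using sorted_nth_mono[OF assms(1), of k] \<open>\<not> xs ! k < s\<close>
      by (force simp: not_less[symmetric])
    from card_mono[OF _ this] len show False
      by (simp add: length_filter_conv_card)
  qed
qed

text \<open>Trades the order statistic for a count of strictly smaller scores. The count does not
  depend on the order of the scores and is visibly measurable, which is what the symmetry argument
  uses.\<close>

lemma conformal_quantile_less_iff:
  assumes "0 < \<epsilon>" "\<epsilon> < 1"
  shows "conformal_quantile N \<epsilon> R < ereal s \<longleftrightarrow>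
    nat \<lceil>real (N + 1) * (1 - \<epsilon>)\<rceil> \<le> card {i\<in>{1..N}. R i < s}"
proof -
  define k where "k = nat \<lceil>real (N + 1) * (1 - \<epsilon>)\<rceil>"
  \<comment> \<open>The bounds \<open>1 \<le> k \<le> N + 1\<close> keep the list index
    \<open>k - 1\<close> from being truncated at 0 and inside the list of length
    \<open>N + 1\<close>.\<close>
  have "real (N + 1) * (1 - \<epsilon>) > 0"
    using assms by simp
  then have k: "1 \<le> k"
    unfolding k_def by linarith
  have "real (N + 1) * (1 - \<epsilon>) \<le> real (N + 1)"
    using assms by (simp add: mult_left_le)
  then have kN: "k \<le> N + 1"
    unfolding k_def by linarith
  have cd: "length (filter (\<lambda>x. x < s) (sort (map R [1..<Suc N]))) = card {i\<in>{1..N}. R i < s}"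
  proof -
    have "length (filter (\<lambda>x. x < s) (sort (map R [1..<Suc N])))
        = length (filter (\<lambda>i. R i < s) [1..<Suc N])"
      by (simp add: filter_sort filter_map comp_def del: upt_Suc)
    also have "\<dots> = card (set (filter (\<lambda>i. R i < s) [1..<Suc N]))"
      by (intro distinct_card[symmetric] distinct_filter distinct_upt)
    also have "set (filter (\<lambda>i. R i < s) [1..<Suc N]) = {i\<in>{1..N}. R i < s}"
      by auto
    finally show ?thesis .
  qed
  show ?thesis
  \<comment> \<open>Rank \<open>N + 1\<close> selects the appended infinity. Both sides are then
    false, since only \<open>N\<close> scores are counted.\<close>
  proof (cases "k = N + 1")
    case True
    have "card {i\<in>{1..N}. R i < s} \<le> N"
      using card_mono[of "{1..N}" "{i\<in>{1..N}. R i < s}"] by (simp add: subset_eq)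
    with True show ?thesis
      unfolding conformal_quantile_def k_def[symmetric] by (simp add: nth_append)
  next
    case False
    with k kN have "k - 1 < N" "Suc (k - 1) = k" by auto
    with sorted_nth_less_iff[of "sort (map R [1..<Suc N])" "k - 1" s, unfolded cd]
    show ?thesis
      unfolding conformal_quantile_def k_def[symmetric]
      by (simp add: nth_append del: upt_Suc)
  qed
qed

text \<open>Choose \<open>j\<close> of least score in the set to be bounded. The indices scoring
  strictly below \<open>S j\<close>, at least \<open>k\<close> of them, all lie outside that set.
  Comparing strictly makes this work in the presence of ties.\<close>

lemma card_rank_ge:
  fixes S :: "'i \<Rightarrow> 'b::linorder"
  assumes "finite I" "k \<le> card I"
  shows "card {j\<in>I. k \<le> card {i\<in>I. S i < S j}} \<le> card I - k"
proof (cases "{j\<in>I. k \<le> card {i\<in>I. S i < S j}} = {}")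
  case False
  let ?J = "{j\<in>I. k \<le> card {i\<in>I. S i < S j}}"
  have "finite ?J" using assms by simp
  with False obtain j where j: "j \<in> ?J" "\<forall>i\<in>?J. S j \<le> S i"
    using ex_min_if_finite[of "S ` ?J"] by (force simp: not_less)
  then have "?J \<subseteq> I - {i\<in>I. S i < S j}" by (auto simp: not_less)
  then have "card ?J \<le> card (I - {i\<in>I. S i < S j})"
    using assms by (intro card_mono) auto
  also have "\<dots> = card I - card {i\<in>I. S i < S j}"
    using assms by (intro card_Diff_subset) auto
  also have "\<dots> \<le> card I - k" using j by auto
  finally show ?thesis .
next
  case True
  show ?thesis unfolding True by simp
qed

section \<open>Lower bounds for conditional expectations\<close>

text \<open>Test the hypothesis on the set \<open>A\<close> where the conditional expectation falls
  below \<open>c\<close>. There the deficit is strictly positive, yet its integral is at most 0, so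
  \<open>A\<close> is a null set.\<close>

lemma (in finite_measure_subalgebra) real_cond_exp_ge_of_set_integral_ge:
  fixes f :: "'a \<Rightarrow> real"
  assumes f: "integrable M f"
    and "\<And>A. A \<in> sets F \<Longrightarrow> c * measure M A \<le> (LINT x:A|M. f x)"
  shows "AE x in M. c \<le> real_cond_exp M F f x"
proof -
  let ?f = "real_cond_exp M F f"
  define A where "A = {x \<in> space F. ?f x < c}"
  have AF: "A \<in> sets F" unfolding A_def by measurable
  then have AM: "A \<in> sets M" using subalg by (auto simp: subalgebra_def)
  have int: "integrable M ?f" using f by (rule real_cond_exp_int)
  then have intA: "integrable M (\<lambda>x. indicator A x * ?f x)"
    using AM integrable_mult_indicator[of A M ?f] by simp
  have intc: "integrable M (\<lambda>x. indicator A x * c)"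
    using AM by (auto intro!: integrable_mult_left integrable_real_indicator simp: emeasure_eq_measure)
  have nonneg: "0 \<le> indicator A x * (c - ?f x)" for x
    by (auto simp: A_def indicator_def)
  have "(LINT x|M. indicator A x * (c - ?f x)) = c * measure M A - (LINT x:A|M. ?f x)"
    using intA intc AM
    by (simp add: right_diff_distrib set_lebesgue_integral_def mult.commute[of _ c])
  also have "\<dots> \<le> 0"
    using assms(2)[OF AF] real_cond_exp_intA[OF f AF] by simp
  finally have "(LINT x|M. indicator A x * (c - ?f x)) = 0"
    using integral_nonneg_AE[OF AE_I2[of M "\<lambda>x. 0 \<le> indicator A x * (c - ?f x)"]] nonneg
    by (simp add: order.antisym)
  moreover have "integrable M (\<lambda>x. indicator A x * (c - ?f x))"
    using Bochner_Integration.integrable_diff[OF intc intA] by (simp add: right_diff_distrib)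
  ultimately have "AE x in M. indicator A x * (c - ?f x) = 0"
    using nonneg by (subst (asm) integral_nonneg_eq_0_iff_AE) auto
  with AE_space show ?thesis
  proof eventually_elim
    case (elim x)
    then show ?case
      using subalg by (cases "x \<in> A") (auto simp: A_def subalgebra_def)
  qed
qed

section \<open>Exchangeability jointly with the training sigma-algebra\<close>

lemma measurable_PiM_permuted:
  assumes "\<pi> permutes I" "\<And>i. i \<in> I \<Longrightarrow> X i \<in> measurable M N"
  shows "(\<lambda>z. \<lambda>i\<in>I. X (\<pi> i) z) \<in> measurable M (\<Pi>\<^sub>M i\<in>I. N)"
  using assms by (intro measurable_restrict) (auto simp: permutes_in_image)

text \<open>Pairing the vector with \<open>z\<close> itself lets \<open>C\<close> involve any training-measurable quantity.\<close>

lemma cond_exchangeable_joint: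
  fixes X :: "'i \<Rightarrow> 'a \<Rightarrow> 'b::topological_space"
  assumes "prob_space M" and sub: "subalgebra M F"
    and X: "\<And>i. i \<in> I \<Longrightarrow> X i \<in> measurable M borel"
    and exch: "cond_exchangeable M F I X"
    and \<pi>: "\<pi> permutes I"
    and C: "C \<in> sets (F \<Otimes>\<^sub>M (\<Pi>\<^sub>M i\<in>I. borel))"
  shows "measure M {z \<in> space M. (z, \<lambda>i\<in>I. X (\<pi> i) z) \<in> C} =
    measure M {z \<in> space M. (z, \<lambda>i\<in>I. X i z) \<in> C}"
proof -
  interpret prob_space M by fact
  interpret finite_measure_subalgebra M F by unfold_locales (fact sub)
  let ?P = "\<Pi>\<^sub>M i\<in>I. (borel :: 'b measure)"
  let ?Y = "\<lambda>\<pi> z. \<lambda>i\<in>I. X (\<pi> i) z"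
  \<comment> \<open>The first coordinate carries only the coarser sigma-algebra \<open>F\<close>;
    the claim is that these joint laws agree for \<open>\<pi>\<close> and the identity.\<close>
  let ?D = "\<lambda>\<pi>. distr M (F \<Otimes>\<^sub>M ?P) (\<lambda>z. (z, ?Y \<pi> z))"
  have FM: "space F = space M" "sets F \<subseteq> sets M" using sub by (auto simp: subalgebra_def)
  have idF: "(\<lambda>z. z) \<in> measurable M F"
    using FM by (auto intro!: measurableI simp: Int_absorb1 sets.sets_into_space)
  have Y: "?Y p \<in> measurable M ?P" if "p permutes I" for p
    using measurable_PiM_permuted[OF that X] .
  have Z: "(\<lambda>z. (z, ?Y p z)) \<in> measurable M (F \<Otimes>\<^sub>M ?P)" if "p permutes I" for p
    using idF Y[OF that] by (rule measurable_Pair)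
  \<comment> \<open>On a rectangle, the joint probability is the integral over \<open>A\<close> of a
    conditional probability, and exchangeability equates the two integrands almost
    everywhere.\<close>
  have rect: "measure M (A \<inter> {z \<in> space M. ?Y \<pi> z \<in> B}) = measure M (A \<inter> {z \<in> space M. ?Y id z \<in> B})"
    if A: "A \<in> sets F" and B: "B \<in> sets ?P" for A B
  proof -
    have AM: "A \<in> sets M" using A FM by auto
    have E: "{z \<in> space M. ?Y p z \<in> B} \<in> sets M" if "p permutes I" for p
      using measurable_sets[OF Y[OF that] B] by (simp add: vimage_def Int_def conj_commute)
    have eq: "measure M (A \<inter> {z \<in> space M. ?Y p z \<in> B}) =
        (LINT x:A|M. cond_probability M F {z \<in> space M. ?Y p z \<in> B} x)" if "p permutes I" for p
    proof -
      have "(LINT x:A|M. indicat_real {z \<in> space M. ?Y p z \<in> B} x) =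
          measure M (A \<inter> {z \<in> space M. ?Y p z \<in> B})"
        using AM E[OF that]
        by (simp add: set_lebesgue_integral_def indicator_inter_arith[symmetric] Int_absorb2 sets.sets_into_space)
      moreover have "integrable M (indicat_real {z \<in> space M. ?Y p z \<in> B})"
        using E[OF that] by (simp add: integrable_real_indicator emeasure_eq_measure)
      ultimately show ?thesis
        unfolding cond_probability_def using real_cond_exp_intA[OF _ A] by simp
    qed
    have "AE x in M. cond_probability M F {z \<in> space M. ?Y \<pi> z \<in> B} x =
        cond_probability M F {z \<in> space M. ?Y id z \<in> B} x"
      using exch \<pi> B by (auto simp: cond_exchangeable_def)
    then have "(LINT x:A|M. cond_probability M F {z \<in> space M. ?Y \<pi> z \<in> B} x) =
        (LINT x:A|M. cond_probability M F {z \<in> space M. ?Y id z \<in> B} x)"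
      unfolding set_lebesgue_integral_def cond_probability_def
      using AM by (intro integral_cong_AE) auto
    then show ?thesis using eq[OF \<pi>] eq[OF permutes_id] by simp
  qed
  \<comment> \<open>Rectangles are stable under intersection and generate the product. As the laws
    are finite, the constant sequence of the whole space serves as exhaustion.\<close>
  have D_eq: "?D \<pi> = ?D id"
  proof (rule measure_eqI_generator_eq[where E = "{a \<times> b |a b. a \<in> sets F \<and> b \<in> sets ?P}"
        and \<Omega> = "space F \<times> space ?P" and A = "\<lambda>_. space F \<times> space ?P"])
    show "Int_stable {a \<times> b |a b. a \<in> sets F \<and> b \<in> sets ?P}"
      by (rule Int_stable_pair_measure_generator)
    show "{a \<times> b |a b. a \<in> sets F \<and> b \<in> sets ?P} \<subseteq> Pow (space F \<times> space ?P)"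
      by (rule pair_measure_closed)
    show "sets (?D p) = sigma_sets (space F \<times> space ?P) {a \<times> b |a b. a \<in> sets F \<and> b \<in> sets ?P}" for p
      by (simp add: sets_pair_measure)
    then show "sets (?D p) = sigma_sets (space F \<times> space ?P) {a \<times> b |a b. a \<in> sets F \<and> b \<in> sets ?P}" for p .
    show "range (\<lambda>_. space F \<times> space ?P) \<subseteq> {a \<times> b |a b. a \<in> sets F \<and> b \<in> sets ?P}"
      by blast
    show "emeasure (?D \<pi>) (space F \<times> space ?P) \<noteq> \<infinity>"
      using \<pi> Z by (simp add: emeasure_distr emeasure_eq_measure)
    fix R assume "R \<in> {a \<times> b |a b. a \<in> sets F \<and> b \<in> sets ?P}"
    then obtain A B where R: "R = A \<times> B" "A \<in> sets F" "B \<in> sets ?P" by auto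
    have "(\<lambda>z. (z, ?Y p z)) -` R \<inter> space M = A \<inter> {z \<in> space M. ?Y p z \<in> B}" for p
      using R(1) by auto
    moreover have "R \<in> sets (F \<Otimes>\<^sub>M ?P)" using R by (simp add: pair_measureI)
    ultimately have em: "emeasure (?D p) R = measure M (A \<inter> {z \<in> space M. ?Y p z \<in> B})"
      if "p permutes I" for p
      using emeasure_distr[OF Z[OF that]] by (simp only: emeasure_eq_measure)
    show "emeasure (?D \<pi>) R = emeasure (?D id) R"
      unfolding em[OF \<pi>] em[OF permutes_id] rect[OF R(2,3)] ..
  qed simp
  have "measure (?D p) C = measure M {z \<in> space M. (z, ?Y p z) \<in> C}"
    if "p permutes I" for p
    unfolding measure_distr[OF Z[OF that] C]
    by (intro arg_cong[where f = "measure M"]) auto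
  from this[OF \<pi>] this[OF permutes_id]
  have "measure M {z \<in> space M. (z, ?Y \<pi> z) \<in> C} = measure M {z \<in> space M. (z, ?Y id z) \<in> C}"
    unfolding D_eq by simp
  then show ?thesis by simp
qed

section \<open>Rank bounds for exchangeable scores\<close>

lemma sets_rank_ge:
  fixes S :: "'i \<Rightarrow> 'a \<Rightarrow> real"
  assumes "finite I" "\<And>i. i \<in> I \<Longrightarrow> S i \<in> borel_measurable M" "T \<in> borel_measurable M"
  shows "{z \<in> space M. k \<le> card {i\<in>I. S i z < T z}} \<in> sets M"
proof -
  have "card {i\<in>I. S i z < T z} = (\<Sum>i\<in>I. if S i z < T z then 1 else 0)" for z
    using assms(1) by (simp add: sum.If_cases Int_def)
  moreover have "(\<lambda>z. \<Sum>i\<in>I. if S i z < T z then 1 else 0 :: nat) \<in> measurable M (count_space UNIV)"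
    using assms by measurable
  ultimately show ?thesis by simp
qed

text \<open>Summing the probabilities of the equally likely rank events gives the expected number of
  them that occur, which \<open>card_rank_ge\<close> bounds pointwise. The score function
  \<open>h z\<close> may itself be random, provided that it depends on \<open>z\<close> only through
  \<open>F\<close>.\<close>

lemma exchangeable_rank_bound:
  fixes X :: "'i \<Rightarrow> 'a \<Rightarrow> 'b::topological_space" and h :: "'a \<Rightarrow> 'b \<Rightarrow> real"
  assumes "prob_space M" and sub: "subalgebra M F"
    and X: "\<And>i. i \<in> I \<Longrightarrow> X i \<in> measurable M borel"
    and exch: "cond_exchangeable M F I X"
    and h: "case_prod h \<in> borel_measurable (F \<Otimes>\<^sub>M borel)"
    and I: "finite I" "n \<in> I" "k \<le> card I"
    and A: "A \<in> sets F"
  shows "card I * measure M {z\<in>A. k \<le> card {i\<in>I. h z (X i z) < h z (X n z)}}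
     \<le> (card I - k) * measure M A"
proof -
  interpret prob_space M by fact
  have FM: "space F = space M" "sets F \<subseteq> sets M" using sub by (auto simp: subalgebra_def)
  have AM: "A \<in> sets M" "A \<subseteq> space M" using A FM sets.sets_into_space[of A F] by auto
  have hX: "(\<lambda>z. h z (X i z)) \<in> borel_measurable M" if "i \<in> I" for i
  proof -
    have "(\<lambda>z. z) \<in> measurable M F"
      using FM by (auto intro!: measurableI simp: Int_absorb1 sets.sets_into_space)
    then have "(\<lambda>z. (z, X i z)) \<in> measurable M (F \<Otimes>\<^sub>M borel)"
      using X[OF that] by (rule measurable_Pair)
    from measurable_compose[OF this h] show ?thesis by simp
  qed
  define E where "E j = {z\<in>A. k \<le> card {i\<in>I. h z (X i z) < h z (X j z)}}" for j
  have E: "E j \<in> sets M" if "j \<in> I" for j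
  proof -
    have "E j = A \<inter> {z \<in> space M. k \<le> card {i\<in>I. h z (X i z) < h z (X j z)}}"
      using AM by (auto simp: E_def)
    then show ?thesis using AM sets_rank_ge[OF I(1) hX hX[OF that]] by auto
  qed
  have eq: "measure M (E j) = measure M (E n)" if j: "j \<in> I" for j
  proof -
    let ?Q = "F \<Otimes>\<^sub>M (\<Pi>\<^sub>M i\<in>I. (borel :: 'b measure))"
    \<comment> \<open>The ranked coordinate \<open>n\<close> stays fixed here; permuting the vector
      decides which observation sits there.\<close>
    define C where "C = {p \<in> space ?Q. fst p \<in> A} \<inter>
        {p \<in> space ?Q. k \<le> card {i\<in>I. h (fst p) (snd p i) < h (fst p) (snd p n)}}"
    have "(\<lambda>p. (fst p, snd p i)) \<in> measurable ?Q (F \<Otimes>\<^sub>M borel)" if "i \<in> I" for i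
      using that by measurable
    from measurable_compose[OF this h]
    have "(\<lambda>p. h (fst p) (snd p i)) \<in> borel_measurable ?Q" if "i \<in> I" for i
      using that by simp
    then have "C \<in> sets ?Q"
      unfolding C_def using I A by (intro sets.Int sets_rank_ge) auto
    let ?\<pi> = "Transposition.transpose j n"
    have \<pi>: "?\<pi> permutes I" using j I by (simp add: permutes_swap_id)
    have sp: "(z, \<lambda>i\<in>I. X (p i) z) \<in> space ?Q" if "z \<in> A" for z p
      using that AM FM by (auto simp: space_pair_measure space_PiM)
    \<comment> \<open>The swap moves \<open>X j\<close> into coordinate \<open>n\<close>. The count
      runs over all of \<open>I\<close>, so the swap merely reindexes it; being an involution, it is
      its own inverse.\<close>
    have "card {i\<in>I. h z (X (?\<pi> i) z) < h z (X j z)} = card {i\<in>I. h z (X i z) < h z (X j z)}" for z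
    proof (rule bij_betw_same_card[of ?\<pi>])
      show "bij_betw ?\<pi> {i\<in>I. h z (X (?\<pi> i) z) < h z (X j z)} {i\<in>I. h z (X i z) < h z (X j z)}"
        using \<pi> by (intro bij_betw_byWitness[where f' = ?\<pi>]) (auto simp: permutes_in_image)
    qed
    then have "{z \<in> space M. (z, \<lambda>i\<in>I. X (?\<pi> i) z) \<in> C} = E j"
      using sp[of _ ?\<pi>] I AM by (auto simp: C_def E_def cong: conj_cong)
    moreover have "{z \<in> space M. (z, \<lambda>i\<in>I. X i z) \<in> C} = E n"
      using sp[of _ id] I AM by (auto simp: C_def E_def cong: conj_cong)
    ultimately show ?thesis
      using cond_exchangeable_joint[OF assms(1) sub X exch \<pi> \<open>C \<in> sets ?Q\<close>] by simp
  qed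
  have "card I * measure M (E n) = (\<Sum>j\<in>I. measure M (E j))"
    using eq by simp
  also have "\<dots> = (\<Sum>j\<in>I. (LINT z|M. indicator (E j) z))"
    using E by (intro sum.cong) (simp_all add: Int_absorb2 sets.sets_into_space)
  also have "\<dots> = (LINT z|M. (\<Sum>j\<in>I. indicator (E j) z))"
    using E by (intro Bochner_Integration.integral_sum[symmetric])
      (auto simp: integrable_real_indicator emeasure_eq_measure)
  also have "\<dots> \<le> (LINT z|M. real (card I - k) * indicator A z)"
  proof (rule integral_mono)
    show "integrable M (\<lambda>z. \<Sum>j\<in>I. indicator (E j) z :: real)"
      using E by (intro Bochner_Integration.integrable_sum)
        (auto simp: integrable_real_indicator emeasure_eq_measure)
    show "integrable M (\<lambda>z. real (card I - k) * indicator A z)"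
      using AM by (auto intro!: integrable_mult_right integrable_real_indicator simp: emeasure_eq_measure)
    \<comment> \<open>Off \<open>A\<close> no event \<open>E j\<close> occurs; on \<open>A\<close>
      the deterministic rank count applies to the realized scores.\<close>
    fix z
    have "(\<Sum>j\<in>I. indicator (E j) z :: real) = card {j\<in>I. z \<in> E j}"
      using I by (simp add: indicator_def sum.If_cases Int_def)
    also have "\<dots> \<le> real (card I - k) * indicator A z"
      using card_rank_ge[OF I(1,3), of "\<lambda>i. h z (X i z)"] by (auto simp: E_def indicator_def)
    finally show "(\<Sum>j\<in>I. indicator (E j) z) \<le> real (card I - k) * indicator A z" .
  qed
  also have "\<dots> = (card I - k) * measure M A"
    using AM by (simp add: Int_absorb2)
  finally show ?thesis unfolding E_def .
qed

text \<open>
  The new observation has index \<open>Suc N\<close>. Its own score never lies strictly below itself, so ranking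
  it among \<open>{1..Suc N}\<close> or among \<open>{1..N}\<close> makes no difference.
\<close>

lemma conformal_tail_bound:
  fixes X :: "nat \<Rightarrow> 'a \<Rightarrow> 'b::topological_space" and h :: "'a \<Rightarrow> 'b \<Rightarrow> real"
  assumes "prob_space M" and "subalgebra M F"
    and "\<And>i. i \<in> {1..Suc N} \<Longrightarrow> X i \<in> measurable M borel"
    and "cond_exchangeable M F {1..Suc N} X"
    and "case_prod h \<in> borel_measurable (F \<Otimes>\<^sub>M borel)"
    and \<epsilon>: "0 < \<epsilon>" "\<epsilon> < 1"
    and "A \<in> sets F"
  shows "measure M {z\<in>A. conformal_quantile N \<epsilon> (\<lambda>i. h z (X i z)) < ereal (h z (X (Suc N) z))}
     \<le> \<epsilon> * measure M A"
proof -
  let ?k = "nat \<lceil>real (N + 1) * (1 - \<epsilon>)\<rceil>"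
  have "real (N + 1) * (1 - \<epsilon>) \<le> real (N + 1)"
    using \<epsilon> by (simp add: mult_left_le)
  then have k: "?k \<le> Suc N" by linarith
  \<comment> \<open>Rounding the rank up is favourable: it gives
    \<open>Suc N - ?k \<le> Suc N * \<epsilon>\<close>, which turns the rank bound into the level
    \<open>\<epsilon>\<close>.\<close>
  have k': "real (N + 1) * (1 - \<epsilon>) \<le> real ?k" by linarith
  have "{i\<in>{1..Suc N}. h z (X i z) < h z (X (Suc N) z)} =
      {i\<in>{1..N}. h z (X i z) < h z (X (Suc N) z)}" for z
    by (auto simp: le_Suc_eq)
  then have "{z\<in>A. conformal_quantile N \<epsilon> (\<lambda>i. h z (X i z)) < ereal (h z (X (Suc N) z))} =
      {z\<in>A. ?k \<le> card {i\<in>{1..Suc N}. h z (X i z) < h z (X (Suc N) z)}}" (is "?B = _")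
    by (simp only: conformal_quantile_less_iff[OF \<epsilon>])
  then have "real (Suc N) * measure M ?B \<le> real (Suc N - ?k) * measure M A"
    using exchangeable_rank_bound[OF assms(1-5), of "Suc N" ?k A] k assms(8) by simp
  also have "\<dots> \<le> (real (Suc N) * \<epsilon>) * measure M A"
    using k k' by (intro mult_right_mono) (auto simp: of_nat_diff algebra_simps)
  finally show ?thesis
    by (simp only: mult.assoc) (simp del: of_nat_Suc)
qed

section \<open>Measurability of margin violations and line loadings\<close>

lemma sets_conformal_quantile_less:
  assumes "0 < \<epsilon>" "\<epsilon> < 1"
    and "\<And>i. i \<in> {1..N} \<Longrightarrow> S i \<in> borel_measurable M" "T \<in> borel_measurable M"
  shows "{z \<in> space M. conformal_quantile N \<epsilon> (\<lambda>i. S i z) < ereal (T z)} \<in> sets M"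
  unfolding conformal_quantile_less_iff[OF assms(1,2)]
  using assms by (intro sets_rank_ge) auto

lemma borel_measurable_matrix_vector_mult:
  fixes K :: "real^'n::finite^'e::finite"
  shows "(*v) K \<in> borel_measurable borel"
  by (intro borel_measurable_continuous_onI linear_continuous_on matrix_vector_mul_bounded_linear)

lemma borel_measurable_line_deviation:
  fixes K :: "real^'n::finite^'e::finite"
  assumes "m \<in> borel_measurable M" "r \<in> borel_measurable M"
  shows "(\<lambda>z. line_deviation K (m z) l (r z)) \<in> borel_measurable M"
proof -
  have "(\<lambda>v. v $ l) \<in> borel_measurable (borel :: (real^'e) measure)"
    by (intro borel_measurable_continuous_onI continuous_intros)
  then have "(\<lambda>v. (K *v v) $ l) \<in> borel_measurable borel"
    using measurable_compose[OF borel_measurable_matrix_vector_mult] by blast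
  moreover have "(\<lambda>z. r z - m z) \<in> borel_measurable M" using assms by measurable
  ultimately show ?thesis
    unfolding line_deviation_def by (rule measurable_compose[rotated])
qed

section \<open>Coverage of the two-sided line margins\<close>

theorem proposition2:
  fixes M :: "'a measure"
    and G :: "('n::finite, 'e::finite) pre_digraph"
    and b fmax :: "real^'e"
    and \<alpha> :: "real^'n"
    and Ntr Ncal :: nat
    and wtr wcal rtr rcal :: "nat \<Rightarrow> 'a \<Rightarrow> real^'n"
    and wnew rnew \<mu> :: "'a \<Rightarrow> real^'n"
    and g :: "(nat \<Rightarrow> real^'n) \<Rightarrow> real^'n"
    and K :: "real^'n^'e"
    and F :: "'a measure"
    and \<epsilon>p \<epsilon>m \<epsilon> :: real
  assumes "prob_space M"
    and "verts G = UNIV" and "arcs G = UNIV"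
    and "loopfree_digraph G" and "Digraph_Component.connected G"
    and "{v. laplacian G b *v v = 0} = span {1}"
    and "\<forall>l. fmax $ l > 0"
    and K: "K = loading_matrix G b fmax"
    and "\<forall>i. \<alpha> $ i \<ge> 0" and "(\<Sum>i\<in>UNIV. \<alpha> $ i) = 1"
    and "\<forall>j\<in>{1..Ntr}. wtr j \<in> borel_measurable M"
    and "\<forall>i\<in>{1..Ncal}. wcal i \<in> borel_measurable M"
    and "wnew \<in> borel_measurable M"
    and "rtr = (\<lambda>j x. residual \<alpha> (wtr j x))"
    and "rcal = (\<lambda>i x. residual \<alpha> (wcal i x))"
    and "rnew = (\<lambda>x. residual \<alpha> (wnew x))"
    and F: "F = generated_algebra M Ntr rtr"
    and "g \<in> borel_measurable (\<Pi>\<^sub>M j\<in>{1..Ntr}. borel)"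
    and "\<mu> = (\<lambda>x. g (\<lambda>j\<in>{1..Ntr}. rtr j x))"
    and "cond_exchangeable M F {1..Suc Ncal} (rcal(Suc Ncal := rnew))"
    and "0 < \<epsilon>p" and "\<epsilon>p < 1" and "0 < \<epsilon>m" and "\<epsilon>m < 1" and "\<epsilon>p + \<epsilon>m = \<epsilon>"
  shows "\<forall>l. AE x in M.
    cond_probability M F
      {z \<in> space M.
         - lower_margin K (\<mu> z) Ncal (\<lambda>i. rcal i z) \<epsilon>m l
             \<le> ereal (line_deviation K (\<mu> z) l (rnew z)) \<and>
         ereal (line_deviation K (\<mu> z) l (rnew z))
             \<le> upper_margin K (\<mu> z) Ncal (\<lambda>i. rcal i z) \<epsilon>p l} x
      \<ge> 1 - \<epsilon>"
proof
  fix l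
  interpret prob_space M by fact
  have res: "(\<lambda>x. residual \<alpha> (w x)) \<in> borel_measurable M" if "w \<in> borel_measurable M" for w
    unfolding residual_def using that
    by (rule measurable_compose[OF _ borel_measurable_matrix_vector_mult])
  have rtr: "(\<lambda>x. \<lambda>j\<in>{1..Ntr}. rtr j x) \<in> measurable M (\<Pi>\<^sub>M j\<in>{1..Ntr}. borel)"
    using assms(11,14) res by (intro measurable_restrict) auto
  have sub: "subalgebra M F"
    unfolding subalgebra_def F generated_algebra_def
    using sets_image_in_sets[OF _ rtr] by simp
  interpret finite_measure_subalgebra M F by unfold_locales (fact sub)
  define X where "X = rcal(Suc Ncal := rnew)"
  have Xold: "X i = rcal i" if "i \<in> {1..Ncal}" for i using that by (auto simp: X_def)
  have X: "X i \<in> borel_measurable M" if "i \<in> {1..Suc Ncal}" for i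
    using that assms(12,13,15,16) res by (auto simp: X_def le_Suc_eq)
  \<comment> \<open>The mean estimate is a function of the training vectors alone, so centring by it
    yields a score function that is jointly measurable over \<open>F\<close>.\<close>
  have \<mu>F: "\<mu> \<in> borel_measurable F"
  proof -
    have "(\<lambda>x. \<lambda>j\<in>{1..Ntr}. rtr j x) \<in> measurable F (\<Pi>\<^sub>M j\<in>{1..Ntr}. borel)"
      unfolding F generated_algebra_def
      using rtr by (intro measurable_vimage_algebra1) (auto dest: measurable_space)
    then show ?thesis unfolding assms(19) using assms(18) by (rule measurable_compose)
  qed
  have \<mu>M: "\<mu> \<in> borel_measurable M" by (rule measurable_from_subalg[OF sub \<mu>F])
  define y where "y z r = line_deviation K (\<mu> z) l r" for z r
  have "case_prod y \<in> borel_measurable (F \<Otimes>\<^sub>M borel)"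
    unfolding y_def case_prod_beta using \<mu>F
    by (intro borel_measurable_line_deviation measurable_snd)
      (rule measurable_compose[OF measurable_fst])
  then have hp: "case_prod (\<lambda>z r. max (y z r) 0) \<in> borel_measurable (F \<Otimes>\<^sub>M borel)"
    and hm: "case_prod (\<lambda>z r. max (- y z r) 0) \<in> borel_measurable (F \<Otimes>\<^sub>M borel)"
    by (simp_all add: case_prod_beta)
  have yX: "(\<lambda>z. y z (X i z)) \<in> borel_measurable M" if "i \<in> {1..Suc Ncal}" for i
    unfolding y_def using \<mu>M X[OF that] by (rule borel_measurable_line_deviation)
  define Qp where "Qp z = conformal_quantile Ncal \<epsilon>p (\<lambda>i. max (y z (X i z)) 0)" for z
  define Qm where "Qm z = conformal_quantile Ncal \<epsilon>m (\<lambda>i. max (- y z (X i z)) 0)" for z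
  define Bp where "Bp = {z \<in> space M. Qp z < ereal (y z (rnew z))}"
  define Bm where "Bm = {z \<in> space M. Qm z < ereal (- y z (rnew z))}"
  have new: "X (Suc Ncal) = rnew" by (simp add: X_def)
  have ynew: "(\<lambda>z. y z (rnew z)) \<in> borel_measurable M" using yX[of "Suc Ncal"] new by simp
  have B: "Bp \<in> sets M" "Bm \<in> sets M"
    unfolding Bp_def Bm_def Qp_def Qm_def using assms(21-24) yX ynew
    by (auto intro!: sets_conformal_quantile_less)
  let ?E = "{z \<in> space M.
         - lower_margin K (\<mu> z) Ncal (\<lambda>i. rcal i z) \<epsilon>m l
             \<le> ereal (line_deviation K (\<mu> z) l (rnew z)) \<and>
         ereal (line_deviation K (\<mu> z) l (rnew z))
             \<le> upper_margin K (\<mu> z) Ncal (\<lambda>i. rcal i z) \<epsilon>p l}"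
  \<comment> \<open>The margins read indices \<open>1\<close> to \<open>Ncal\<close> only, so
    appending the new residual at \<open>Suc Ncal\<close> does not change them.\<close>
  have quant_cong: "conformal_quantile Ncal e R = conformal_quantile Ncal e R'"
    if "\<And>i. i \<in> {1..Ncal} \<Longrightarrow> R i = R' i" for e R R'
  proof -
    have "map R [1..<Suc Ncal] = map R' [1..<Suc Ncal]" using that by (intro map_cong) auto
    then show ?thesis unfolding conformal_quantile_def by (simp only:)
  qed
  have up: "upper_margin K (\<mu> z) Ncal (\<lambda>i. rcal i z) \<epsilon>p l = Qp z" for z
    unfolding upper_margin_def Qp_def y_def by (intro quant_cong) (simp add: Xold)
  have lo: "lower_margin K (\<mu> z) Ncal (\<lambda>i. rcal i z) \<epsilon>m l = Qm z" for z
    unfolding lower_margin_def Qm_def y_def by (intro quant_cong) (simp add: Xold)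
  \<comment> \<open>Negation turns the lower limit into an upper limit on \<open>- y\<close>, also
    for an infinite margin.\<close>
  have lower_iff: "- Qm z \<le> ereal (y z (rnew z)) \<longleftrightarrow> \<not> Qm z < ereal (- y z (rnew z))" for z
    by (metis ereal_uminus_le_reorder not_less uminus_ereal.simps(1))
  have E: "?E = space M - (Bp \<union> Bm)"
    unfolding up lo Bp_def Bm_def y_def[symmetric] lower_iff
    by (simp only: linorder_not_less[symmetric, of "ereal _"]) blast
  have "AE x in M. 1 - \<epsilon> \<le> real_cond_exp M F (indicat_real ?E) x"
  proof (rule real_cond_exp_ge_of_set_integral_ge)
    have EM: "?E \<in> sets M" using E B by simp
    then show "integrable M (indicat_real ?E)"
      by (simp add: integrable_real_indicator emeasure_eq_measure)
    fix A assume A: "A \<in> sets F"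
    then have AM: "A \<in> sets M" "A \<subseteq> space M"
      using sub sets.sets_into_space by (auto simp: subalgebra_def)
    \<comment> \<open>The violations \<open>Bp\<close> and \<open>Bm\<close> concern the signed
      deviation, while the tail bound concerns its positive part. Passing to the positive part can
      only enlarge the violation event.\<close>
    have less_max: "q < ereal a \<Longrightarrow> q < ereal (max a 0)" for q a
      by (meson ereal_less_eq(3) less_le_trans max.cobounded1)
    let ?Tp = "{z\<in>A. Qp z < ereal (max (y z (rnew z)) 0)}"
    let ?Tm = "{z\<in>A. Qm z < ereal (max (- y z (rnew z)) 0)}"
    have "{z \<in> space M. Qp z < ereal (max (y z (rnew z)) 0)} \<in> sets M"
      "{z \<in> space M. Qm z < ereal (max (- y z (rnew z)) 0)} \<in> sets M"
      unfolding Qp_def Qm_def using assms(21-24) yX ynew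
      by (auto intro!: sets_conformal_quantile_less simp del: ereal_max)
    moreover have "?Tp = A \<inter> {z \<in> space M. Qp z < ereal (max (y z (rnew z)) 0)}"
      "?Tm = A \<inter> {z \<in> space M. Qm z < ereal (max (- y z (rnew z)) 0)}"
      using AM by auto
    ultimately have T: "?Tp \<in> sets M" "?Tm \<in> sets M"
      using AM(1) by (metis (no_types, lifting) sets.Int)+
    have exch: "cond_exchangeable M F {1..Suc Ncal} X" using assms(20) by (simp add: X_def)
    note tail = conformal_tail_bound[OF \<open>prob_space M\<close> sub X exch]
    have "measure M ?Tp \<le> \<epsilon>p * measure M A"
      using tail[OF _ hp _ _ A, of \<epsilon>p] assms(21,22) unfolding Qp_def new by simp
    moreover have "measure M ?Tm \<le> \<epsilon>m * measure M A"
      using tail[OF _ hm _ _ A, of \<epsilon>m] assms(23,24) unfolding Qm_def new by simp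
    \<comment> \<open>Within \<open>A\<close>, failure of coverage lies in the union of the two tail
      events, whose probabilities add up to at most \<open>\<epsilon> * measure M A\<close>.\<close>
    moreover have "measure M (A - A \<inter> ?E) \<le> measure M (?Tp \<union> ?Tm)"
      using T AM less_max by (intro finite_measure_mono) (auto simp: E Bp_def Bm_def)
    moreover have "measure M (?Tp \<union> ?Tm) \<le> measure M ?Tp + measure M ?Tm"
      using T by (rule measure_Un_le)
    moreover have "measure M (A - A \<inter> ?E) = measure M A - measure M (A \<inter> ?E)"
      using AM EM by (intro finite_measure_Diff) auto
    ultimately have "(1 - \<epsilon>) * measure M A \<le> measure M (A \<inter> ?E)"
      using assms(25) by (simp add: algebra_simps flip: assms(25))
    also have "\<dots> = (LINT x:A|M. indicat_real ?E x)"
      using AM EM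
      by (simp add: set_lebesgue_integral_def indicator_inter_arith[symmetric] Int_absorb2 sets.sets_into_space)
    finally show "(1 - \<epsilon>) * measure M A \<le> (LINT x:A|M. indicat_real ?E x)" .
  qed
  then show "AE x in M. cond_probability M F ?E x \<ge> 1 - \<epsilon>"
    unfolding cond_probability_def by simp
qed

end
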